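(* There exists a constant $C>1$ (independent of $g$ and $n$) such that for every twice differentiable function $g:[0,1]\to\mathbb{R}$ with $g''\in AC[0,1]$ and every $n\in\mathbb{N}$, $n\ge 1$, $$V_{[0,1]}[D_n g-g]\le \frac{2(C+1)}{\sqrt{n}}\left\{V_{[0,1]}[g]+V_{[0,1]}[g'']\right\},$$ where $D_n$ denotes the $n$-th Bernstein-Durrmeyer operator.
   Context: For $n\in\mathbb{N}=\{1,2,\dots\}$ and $0\le k\le n$ let $p_{n,k}(x)=\binom{n}{k}x^k(1-x)^{n-k}$. For a Lebesgue integrable function $g$ on $[0,1]$ the Bernstein-Durrmeyer operator is $$(D_n g)(x)=(n+1)\sum_{k=0}^{n}p_{n,k}(x)\int_0^1 p_{n,k}(t)g(t)\,dt,\qquad x\in[0,1].$$ $V_{[0,1]}[h]$ denotes the total Jordan variation of the real-valued function $h$ on $[0,1]$, and $AC[0,1]$ is the space of absolutely continuous real-valued functions on $[0,1]$. *)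

theory Defs
  imports "HOL-Analysis.Analysis"
begin

text \<open>
  The polynomials $p_{n,k}$ are the library's \<^const>\<open>Bernstein\<close>, that is
  \<open>Bernstein n k x = (n choose k) * x^k * (1 - x)^(n - k)\<close>.
\<close>

definition bernstein_durrmeyer :: "nat \<Rightarrow> (real \<Rightarrow> real) \<Rightarrow> real \<Rightarrow> real" where
  "bernstein_durrmeyer n g x =
     (real n + 1) *
     (\<Sum>k=0..n. Bernstein n k x * (LINT t:{0..1}|lebesgue. Bernstein n k t * g t))"

text \<open>
  Total Jordan variation of \<open>h\<close> on \<open>[a, b]\<close>: the supremum over all partitions
  \<open>a = x 0 < x 1 < \<dots> < x m = b\<close>. It is extended-valued, so that functions of
  unbounded variation have variation \<open>\<infinity>\<close>.
\<close>

definition total_variation :: "real \<Rightarrow> real \<Rightarrow> (real \<Rightarrow> real) \<Rightarrow> ennreal" where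
  "total_variation a b h =
     Sup {\<Sum>i<m. ennreal \<bar>h (x (Suc i)) - h (x i)\<bar> | (m::nat) (x::nat \<Rightarrow> real).
            x 0 = a \<and> x m = b \<and> (\<forall>i<m. x i < x (Suc i))}"

text \<open>
  Absolute continuity of a function on \<open>[a, b]\<close>; the library constant
  \<^const>\<open>absolutely_continuous\<close> is a different notion, about measures. A finite
  system of pairwise disjoint open subintervals is given by the set \<open>I\<close> of its
  pairs of endpoints.
\<close>

definition abs_continuous_on_interval :: "real \<Rightarrow> real \<Rightarrow> (real \<Rightarrow> real) \<Rightarrow> bool" where
  "abs_continuous_on_interval a b f \<longleftrightarrow>
     (\<forall>\<epsilon>>0. \<exists>\<delta>>0. \<forall>I :: (real \<times> real) set.
        finite I \<and> (\<forall>(u, v)\<in>I. a \<le> u \<and> u < v \<and> v \<le> b) \<and>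
        disjoint_family_on (\<lambda>(u, v). {u<..<v}) I \<and>
        (\<Sum>(u, v)\<in>I. v - u) < \<delta> \<longrightarrow>
        (\<Sum>(u, v)\<in>I. \<bar>f v - f u\<bar>) < \<epsilon>)"

end

theory Submission
  imports Defs
begin

text \<open>
  Since the total variation on \<open>[0, 1]\<close> is at most the supremum of the absolute derivative, it
  suffices to show that \<open>(D\<^sub>n g)' - g'\<close> is uniformly of order \<open>1 / \<surd>n\<close>, with a factor that is
  controlled by the variations of \<open>g\<close> and \<open>g''\<close>.

  Differentiating the Bernstein polynomials in \<open>x\<close> turns the coefficients
  \<open>\<integral> p\<^bsub>n,k\<^esub> g\<close> into their differences, and an integration by parts in \<open>t\<close> moves that
  difference onto \<open>g\<close>. The result (\<open>has_real_derivative_bernstein_durrmeyer\<close>) is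
  \<open>(D\<^sub>n g)' x = n \<Sum>\<^bsub>k<n\<^esub> p\<^bsub>n-1,k\<^esub> x \<integral> p\<^bsub>n+1,k+1\<^esub> g'\<close>,
  a positive linear operator applied to \<open>g'\<close>. Its mass is \<open>n / (n + 2)\<close>, and its second moment
  about \<open>x\<close> is at most \<open>2 / n\<close> (\<open>durrmeyer_deriv_square_dist\<close>), by the elementary moments of
  the Bernstein polynomials. As in Korovkin's theorem, such an operator approximates \<open>g'\<close> with an
  error at most \<open>(2 sup \<bar>g'\<bar> + 3/2 sup \<bar>g''\<bar>) / \<surd>n\<close>
  (\<open>durrmeyer_deriv_approximation\<close>).

  Finally \<open>sup \<bar>g'\<bar>\<close> and \<open>sup \<bar>g''\<bar>\<close> are bounded by a linear combination of the two
  variations (\<open>derivative_bounds_by_variations\<close>): the mean value theorem gives points where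
  \<open>\<bar>g'\<bar>\<close> and \<open>\<bar>g''\<bar>\<close> are at most a multiple of the variation of \<open>g\<close>, and the oscillation of \<open>g''\<close>
  away from such a point is at most its own variation.
\<close>

section \<open>Total variation and derivatives\<close>

lemma total_variation_ge_partition:
  assumes "x 0 = a" "x m = b" "\<And>i. i < m \<Longrightarrow> x i < x (Suc i)"
  shows "(\<Sum>i<m. ennreal \<bar>h (x (Suc i)) - h (x i)\<bar>) \<le> total_variation a b h"
  unfolding total_variation_def using assms by (intro Sup_upper) blast

lemma total_variation_ge_increment:
  assumes "a \<le> u" "u < v" "v \<le> b"
  shows "ennreal \<bar>h v - h u\<bar> \<le> total_variation a b h"
proof -
  \<comment> \<open>The partition by \<open>a\<close>, \<open>u\<close>, \<open>v\<close>, \<open>b\<close>; an endpoint that coincides with \<open>u\<close> or \<open>v\<close>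
    is dropped, because partitions increase strictly.\<close>
  define xs where "xs = (if a = u then [] else [a]) @ [u, v] @ (if v = b then [] else [b])"
  define m where "m = length xs - 1"
  have "xs ! 0 = a" "xs ! m = b"
    by (auto simp: xs_def m_def)
  moreover have "xs ! i < xs ! Suc i" if "i < m" for i
    using that assms by (auto simp: xs_def m_def less_Suc_eq nth_Cons split: if_splits nat.splits)
  ultimately have "(\<Sum>i<m. ennreal \<bar>h (xs ! Suc i) - h (xs ! i)\<bar>) \<le> total_variation a b h"
    by (rule total_variation_ge_partition)
  moreover have "ennreal \<bar>h v - h u\<bar> \<le> (\<Sum>i<m. ennreal \<bar>h (xs ! Suc i) - h (xs ! i)\<bar>)"
    by (auto simp: xs_def m_def add_increasing add_increasing2)
  ultimately show ?thesis by order
qed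

lemma abs_increment_le_total_variation:
  assumes "total_variation a b h = ennreal V" "0 \<le> V" "u \<in> {a..b}" "v \<in> {a..b}"
  shows "\<bar>h v - h u\<bar> \<le> V"
proof -
  have "\<bar>h w - h z\<bar> \<le> V" if "a \<le> z" "z < w" "w \<le> b" for z w
    using total_variation_ge_increment[OF that, of h] assms(1,2) by simp
  from this[of u v] this[of v u] show ?thesis
    using assms(2-4) by (cases u v rule: linorder_cases) (simp_all add: abs_minus_commute)
qed

lemma total_variation_le_derivative_bound:
  assumes "a \<le> b"
    and deriv: "\<And>x. x \<in> {a..b} \<Longrightarrow> (h has_real_derivative h' x) (at x within {a..b})"
    and bound: "\<And>x. x \<in> {a..b} \<Longrightarrow> \<bar>h' x\<bar> \<le> M"
  shows "total_variation a b h \<le> ennreal (M * (b - a))"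
  unfolding total_variation_def
proof (rule Sup_least, elim CollectE exE conjE)
  fix m y and x :: "nat \<Rightarrow> real"
  assume y: "y = (\<Sum>i<m. ennreal \<bar>h (x (Suc i)) - h (x i)\<bar>)"
    and "x 0 = a" "x m = b" and inc: "\<forall>i<m. x i < x (Suc i)"
  then have ab: "a = x 0" "b = x m" by auto
  have le: "x i \<le> x j" if "i \<le> j" "j \<le> m" for i j
    using that
  proof (induction j rule: dec_induct)
    case (step j)
    then show ?case using inc by (meson Suc_le_lessD less_imp_le order_trans)
  qed simp
  have step: "\<bar>h (x (Suc i)) - h (x i)\<bar> \<le> M * (x (Suc i) - x i)" if "i < m" for i
    using field_differentiable_bound[of "{a..b}" h h' M "x (Suc i)" "x i"]
      deriv bound le[of 0 i] le[of 0 "Suc i"] le[of i m] le[of "Suc i" m] inc that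
    by (auto simp: ab less_imp_le abs_of_pos)
  have "(\<Sum>i<m. \<bar>h (x (Suc i)) - h (x i)\<bar>) \<le> (\<Sum>i<m. M * (x (Suc i) - x i))"
    by (intro sum_mono step) simp
  also have "\<dots> = M * (x m - x 0)"
    by (simp add: sum_lessThan_telescope flip: sum_distrib_left)
  finally show "y \<le> ennreal (M * (b - a))"
    by (simp add: y ab sum_ennreal ennreal_leI)
qed

lemma mvt_within:
  fixes f :: "real \<Rightarrow> real"
  assumes deriv: "\<And>x. x \<in> {a..b} \<Longrightarrow> (f has_real_derivative f' x) (at x within {a..b})"
    and "a \<le> u" "u < v" "v \<le> b"
  obtains \<xi> where "u < \<xi>" "\<xi> < v" "f v - f u = f' \<xi> * (v - u)"
proof -
  have "(f has_derivative (*) (f' x)) (at x within {u..v})" if "u \<le> x" "x \<le> v" for x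
    using DERIV_subset[OF deriv, of x "{u..v}"] that assms by (auto simp: has_field_derivative_def)
  from mvt_simple[OF \<open>u < v\<close> this] show ?thesis using that by auto
qed

text \<open>
  The slopes of \<open>g\<close> over the first and the last third of the interval are at most three times the
  variation of \<open>g\<close>, and they are values of \<open>g'\<close> at two points. These points are at least \<open>1/3\<close>
  apart, so the mean value theorem for \<open>g'\<close> between them yields a point where \<open>\<bar>g''\<bar>\<close> is at most
  \<open>18 V\<close>. From there the variation of \<open>g''\<close> bounds \<open>g''\<close> everywhere, which in turn bounds \<open>g'\<close>.
\<close>

lemma derivative_bounds_by_variations:
  assumes d1: "\<And>x. x \<in> {0..1} \<Longrightarrow> (g has_real_derivative g' x) (at x within {0..1})"
    and d2: "\<And>x. x \<in> {0..1} \<Longrightarrow> (g' has_real_derivative g'' x) (at x within {0..1})"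
    and V: "total_variation 0 1 g = ennreal V" "0 \<le> V"
    and W: "total_variation 0 1 g'' = ennreal W" "0 \<le> W"
    and x: "x \<in> {0..1}"
  shows "\<bar>g'' x\<bar> \<le> 18 * V + W" and "\<bar>g' x\<bar> \<le> 21 * V + W"
proof -
  obtain a where a: "0 < a" "a < 1/3" "g (1/3) - g 0 = g' a * (1/3 - 0)"
    using mvt_within[OF d1, of 0 "1/3"] by auto
  obtain b where b: "2/3 < b" "b < 1" "g 1 - g (2/3) = g' b * (1 - 2/3)"
    using mvt_within[OF d1, of "2/3" 1] by auto
  have ga: "\<bar>g' a\<bar> \<le> 3 * V"
    using abs_increment_le_total_variation[OF V, of 0 "1/3"] a by simp
  have gb: "\<bar>g' b\<bar> \<le> 3 * V"
    using abs_increment_le_total_variation[OF V, of "2/3" 1] b by simp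
  obtain c where c: "a < c" "c < b" "g' b - g' a = g'' c * (b - a)"
    using mvt_within[OF d2, of a b] a b by auto
  have "\<bar>g'' c\<bar> * (1/3) \<le> \<bar>g'' c\<bar> * (b - a)"
    using a b by (intro mult_left_mono) auto
  also have "\<dots> = \<bar>g' b - g' a\<bar>"
    using c by (simp add: abs_mult)
  also have "\<dots> \<le> 6 * V"
    using ga gb by simp
  finally have gc: "\<bar>g'' c\<bar> \<le> 18 * V" by simp
  have M2: "\<bar>g'' y\<bar> \<le> 18 * V + W" if "y \<in> {0..1}" for y
    using abs_increment_le_total_variation[OF W, of c y] gc that a b c by auto
  then show "\<bar>g'' x\<bar> \<le> 18 * V + W" using x .
  have "\<bar>g' x - g' a\<bar> \<le> (18 * V + W) * \<bar>x - a\<bar>"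
    using field_differentiable_bound[of "{0..1}" g' g'' "18 * V + W" x a] d2 M2 x a by auto
  also have "\<dots> \<le> (18 * V + W) * 1"
    using x a V W by (intro mult_left_mono) auto
  finally show "\<bar>g' x\<bar> \<le> 21 * V + W"
    using ga by simp
qed

section \<open>Bernstein polynomials\<close>

lemma Bernstein_eq_0: "n < k \<Longrightarrow> Bernstein n k x = 0"
  by (simp add: Bernstein_def)

lemma continuous_on_Bernstein [continuous_intros]: "continuous_on S (Bernstein n k)"
  unfolding Bernstein_def by (intro continuous_intros)

lemma has_real_derivative_Bernstein_0:
  "(Bernstein (Suc n) 0 has_real_derivative - real (Suc n) * Bernstein n 0 x) (at x within S)"
  using DERIV_power_Suc[of "\<lambda>x. 1 - x" "-1" x S n] DERIV_diff[OF DERIV_const[of 1] DERIV_ident, of x S]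
  unfolding Bernstein_def by (simp add: algebra_simps)

lemma has_real_derivative_Bernstein_Suc:
  "(Bernstein (Suc n) (Suc k) has_real_derivative
     real (Suc n) * (Bernstein n k x - Bernstein n (Suc k) x)) (at x within S)"
proof (cases "n < k")
  case True
  then have "Bernstein (Suc n) (Suc k) = (\<lambda>x. 0)" by (auto simp: Bernstein_eq_0)
  with True show ?thesis by (simp add: Bernstein_eq_0)
next
  case False
  have "real (Suc k) * real (Suc n choose Suc k) = real (Suc n) * real (n choose k)"
    by (metis Suc_times_binomial_eq mult.commute of_nat_mult)
  moreover have "real (n - k) * real (Suc n choose Suc k) = real (Suc n) * real (n choose Suc k)"
    using binomial_absorb_comp[of "Suc n" "Suc k"] by (metis diff_Suc_Suc diff_Suc_1 of_nat_mult)
  ultimately have c: "real (Suc n choose Suc k) * real (Suc k) = real (Suc n) * real (n choose k)"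
    "real (Suc n choose Suc k) * real (n - k) = real (Suc n) * real (n choose Suc k)"
    by (simp_all only: mult.commute)
  have "(Bernstein (Suc n) (Suc k) has_real_derivative
      (real (Suc n choose Suc k) * real (Suc k)) * (x ^ k * (1 - x) ^ (n - k))
      - (real (Suc n choose Suc k) * real (n - k)) * (x ^ Suc k * (1 - x) ^ (n - Suc k))) (at x within S)"
  proof -
    have "((\<lambda>x. 1 - x) has_real_derivative - 1) (at x within S)"
      by (auto intro!: derivative_eq_intros)
    from DERIV_mult[OF DERIV_power_Suc[OF DERIV_ident, of k] DERIV_power[OF this, of "n - k"]]
    have "((\<lambda>x. x ^ Suc k * (1 - x) ^ (n - k)) has_real_derivative
        real (Suc k) * (x ^ k * (1 - x) ^ (n - k))
        - real (n - k) * (x ^ Suc k * (1 - x) ^ (n - Suc k))) (at x within S)"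
      by (simp add: algebra_simps)
    from DERIV_cmult[OF this, of "real (Suc n choose Suc k)"] show ?thesis
      unfolding Bernstein_def by (simp only: diff_Suc_Suc right_diff_distrib mult.assoc)
  qed
  then show ?thesis
    unfolding c Bernstein_def by (simp add: algebra_simps)
qed

text \<open>
  Abel summation: the derivative of each Bernstein polynomial is a difference of two neighbours of
  lower degree, and summation by parts moves that difference onto the coefficients.
\<close>

lemma has_real_derivative_Bernstein_combination:
  "((\<lambda>x. \<Sum>k\<le>Suc N. Bernstein (Suc N) k x * c k) has_real_derivative
     real (Suc N) * (\<Sum>k\<le>N. Bernstein N k x * (c (Suc k) - c k))) (at x within S)"
proof -
  have "(\<Sum>k\<le>N. Bernstein N (Suc k) x * c (Suc k)) + Bernstein N 0 x * c 0
      = (\<Sum>k\<le>Suc N. Bernstein N k x * c k)"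
    by (simp add: sum.atMost_Suc_shift del: sum.atMost_Suc)
  also have "\<dots> = (\<Sum>k\<le>N. Bernstein N k x * c k)"
    by (simp add: Bernstein_eq_0)
  finally have shift: "(\<Sum>k\<le>N. Bernstein N (Suc k) x * c (Suc k)) =
      (\<Sum>k\<le>N. Bernstein N k x * c k) - Bernstein N 0 x * c 0" by simp
  have "((\<lambda>x. Bernstein (Suc N) 0 x * c 0 + (\<Sum>k\<le>N. Bernstein (Suc N) (Suc k) x * c (Suc k)))
      has_real_derivative (- real (Suc N) * Bernstein N 0 x) * c 0 +
      (\<Sum>k\<le>N. real (Suc N) * (Bernstein N k x - Bernstein N (Suc k) x) * c (Suc k))) (at x within S)"
    by (intro DERIV_add DERIV_sum DERIV_cmult_right has_real_derivative_Bernstein_0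
        has_real_derivative_Bernstein_Suc)
  also have "(- real (Suc N) * Bernstein N 0 x) * c 0 +
      (\<Sum>k\<le>N. real (Suc N) * (Bernstein N k x - Bernstein N (Suc k) x) * c (Suc k)) =
      real (Suc N) * ((\<Sum>k\<le>N. Bernstein N k x * c (Suc k)) -
        (\<Sum>k\<le>N. Bernstein N (Suc k) x * c (Suc k)) - Bernstein N 0 x * c 0)"
    by (simp add: left_diff_distrib right_diff_distrib sum_subtractf sum_distrib_left mult.assoc
        del: of_nat_Suc)
  also have "\<dots> = real (Suc N) * (\<Sum>k\<le>N. Bernstein N k x * (c (Suc k) - c k))"
    unfolding shift by (simp add: right_diff_distrib sum_subtractf)
  finally show ?thesis
    by (simp add: sum.atMost_Suc_shift del: sum.atMost_Suc)
qed

lemma Bernstein_Suc_Suc_at_0: "Bernstein n (Suc k) 0 = 0"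
  by (simp add: Bernstein_def)

lemma Bernstein_at_1: "Bernstein n k 1 = (if k = n then 1 else 0)"
  by (auto simp: Bernstein_def not_less Bernstein_eq_0)

text \<open>
  The integrand is the derivative of \<open>Bernstein (Suc m) (Suc j)\<close>, which vanishes at \<open>0\<close>, and at
  \<open>1\<close> as well unless it is the last one. So all Bernstein polynomials of one degree have the same
  integral, and the case \<open>j = m\<close> determines its value.
\<close>

lemma has_integral_Bernstein_diff:
  "((\<lambda>t. real (Suc m) * (Bernstein m j t - Bernstein m (Suc j) t)) has_integral
     (if j = m then 1 else 0)) {0..1}"
  using fundamental_theorem_of_calculus[of 0 1 "Bernstein (Suc m) (Suc j)"]
    has_real_derivative_Bernstein_Suc[of m j]
  by (auto simp: has_real_derivative_iff_has_vector_derivative Bernstein_at_1 Bernstein_Suc_Suc_at_0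
      split: if_splits)

lemma integral_Bernstein:
  assumes "j \<le> m"
  shows "integral {0..1} (Bernstein m j) = 1 / (real m + 1)"
proof -
  have int: "Bernstein m j integrable_on {0..1}" for j
    by (intro integrable_continuous_interval continuous_intros)
  have diff: "real (Suc m) * (integral {0..1} (Bernstein m j) - integral {0..1} (Bernstein m (Suc j)))
      = (if j = m then 1 else 0)" for j
    using integral_unique[OF has_integral_Bernstein_diff[of m j]] int
    by (simp add: Henstock_Kurzweil_Integration.integral_diff)
  have "Bernstein m (Suc m) = (\<lambda>t. 0)"
    by (auto simp: Bernstein_eq_0)
  then have top: "integral {0..1} (Bernstein m m) = 1 / (real m + 1)"
    using diff[of m] by (simp add: field_simps)
  show ?thesis
    using assms
  proof (induction j rule: inc_induct)
    case base
    show ?case by (rule top)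
  next
    case (step j)
    then show ?case using diff[of j] by simp
  qed
qed

text \<open>
  Multiplication by the variable only shifts the indices and rescales, so that every moment of a
  Bernstein polynomial reduces to the integral of another one.
\<close>

lemma mult_Bernstein:
  "t * Bernstein m j t = (real j + 1) / (real m + 1) * Bernstein (Suc m) (Suc j) t"
proof -
  have "real (Suc j) * real (Suc m choose Suc j) = real (Suc m) * real (m choose j)"
    by (metis Suc_times_binomial_eq mult.commute of_nat_mult)
  then have "real (m choose j) = (real j + 1) / (real m + 1) * real (Suc m choose Suc j)"
    by (simp add: field_simps del: binomial_Suc_Suc)
  then show ?thesis
    by (simp add: Bernstein_def del: binomial_Suc_Suc)
qed

lemma integral_mult_Bernstein:
  assumes "j \<le> m"
  shows "integral {0..1} (\<lambda>t. t * Bernstein m j t) = (real j + 1) / ((real m + 1) * (real m + 2))"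
  unfolding mult_Bernstein using integral_Bernstein[of "Suc j" "Suc m"] assms
  by (simp add: add.commute)

lemma integral_square_mult_Bernstein:
  assumes "j \<le> m"
  shows "integral {0..1} (\<lambda>t. t\<^sup>2 * Bernstein m j t) =
    (real j + 1) * (real j + 2) / ((real m + 1) * (real m + 2) * (real m + 3))"
proof -
  have "(\<lambda>t. t\<^sup>2 * Bernstein m j t) =
      (\<lambda>t. (real j + 1) / (real m + 1) * (t * Bernstein (Suc m) (Suc j) t))"
    by (rule ext) (metis mult_Bernstein mult.left_commute power2_eq_square mult.assoc)
  then have "integral {0..1} (\<lambda>t. t\<^sup>2 * Bernstein m j t) =
      (real j + 1) / (real m + 1) * ((real j + 2) / ((real m + 2) * (real m + 3)))"
    using integral_mult_Bernstein[of "Suc j" "Suc m"] assms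
    by (simp add: add.commute del: times_divide_eq_left times_divide_eq_right)
  then show ?thesis by simp
qed

lemma integral_square_dist_Bernstein:
  assumes "j \<le> m"
  shows "integral {0..1} (\<lambda>t. Bernstein m j t * (t - x)\<^sup>2) =
    (real j + 1) * (real j + 2) / ((real m + 1) * (real m + 2) * (real m + 3))
    - 2 * x * ((real j + 1) / ((real m + 1) * (real m + 2))) + x\<^sup>2 * (1 / (real m + 1))"
proof -
  have e: "(\<lambda>t. Bernstein m j t * (t - x)\<^sup>2) =
     (\<lambda>t. t\<^sup>2 * Bernstein m j t - (2 * x) * (t * Bernstein m j t) + x\<^sup>2 * Bernstein m j t)"
    by (auto simp: power2_eq_square algebra_simps)
  have "(\<lambda>t. t\<^sup>2 * Bernstein m j t) integrable_on {0..1}"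
    "(\<lambda>t. (2 * x) * (t * Bernstein m j t)) integrable_on {0..1}"
    "(\<lambda>t. x\<^sup>2 * Bernstein m j t) integrable_on {0..1}"
    by (intro integrable_continuous_interval continuous_intros)+
  then show ?thesis unfolding e
    using integral_Bernstein[OF assms] integral_mult_Bernstein[OF assms]
      integral_square_mult_Bernstein[OF assms]
    by (simp add: Henstock_Kurzweil_Integration.integral_diff
        Henstock_Kurzweil_Integration.integral_add integrable_diff)
qed

section \<open>The derivative of the Bernstein-Durrmeyer operator\<close>

text \<open>
  The positive operator that maps \<open>g'\<close> to the derivative of \<open>bernstein_durrmeyer n g\<close>, where
  \<open>n = N + 1\<close>; it is indexed by the degree \<open>N = n - 1\<close> of the outer polynomials.
\<close>

definition durrmeyer_deriv :: "nat \<Rightarrow> (real \<Rightarrow> real) \<Rightarrow> real \<Rightarrow> real" where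
  "durrmeyer_deriv N \<phi> x = real (Suc N) *
     (\<Sum>k\<le>N. Bernstein N k x * integral {0..1} (\<lambda>t. Bernstein (N + 2) (Suc k) t * \<phi> t))"

text \<open>
  The difference of neighbouring Bernstein polynomials is a multiple of the derivative of
  \<open>Bernstein (Suc n) (Suc k)\<close>. The boundary terms vanish because \<open>0 < Suc k < Suc n\<close>.
\<close>

lemma integral_Bernstein_by_parts:
  assumes d: "\<And>x. x \<in> {0..1} \<Longrightarrow> (g has_real_derivative g' x) (at x within {0..1})"
    and cont: "continuous_on {0..1} g'" and "k < n"
  shows "(real n + 1) * (integral {0..1} (\<lambda>t. Bernstein n (Suc k) t * g t) -
      integral {0..1} (\<lambda>t. Bernstein n k t * g t)) =
    integral {0..1} (\<lambda>t. Bernstein (Suc n) (Suc k) t * g' t)"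
proof -
  have cg: "continuous_on {0..1} g"
    using d DERIV_continuous_on by blast
  have i: "(\<lambda>t. Bernstein m j t * g t) integrable_on {0..1}"
    "(\<lambda>t. Bernstein m j t * g' t) integrable_on {0..1}" for m j
    by (intro integrable_continuous_interval continuous_intros cg cont)+
  have "((\<lambda>t. Bernstein (Suc n) (Suc k) t * g t) has_vector_derivative
      real (Suc n) * (Bernstein n k t - Bernstein n (Suc k) t) * g t
      + g' t * Bernstein (Suc n) (Suc k) t) (at t within {0..1})" if "t \<in> {0..1}" for t
    using DERIV_mult[OF has_real_derivative_Bernstein_Suc d[OF that]]
    by (simp add: has_real_derivative_iff_has_vector_derivative)
  from fundamental_theorem_of_calculus[OF _ this]
  have "((\<lambda>t. real (Suc n) * (Bernstein n k t - Bernstein n (Suc k) t) * g t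
      + g' t * Bernstein (Suc n) (Suc k) t) has_integral 0) {0..1}"
    using \<open>k < n\<close> by (simp add: Bernstein_at_1 Bernstein_Suc_Suc_at_0)
  also have "(\<lambda>t. real (Suc n) * (Bernstein n k t - Bernstein n (Suc k) t) * g t
      + g' t * Bernstein (Suc n) (Suc k) t) =
      (\<lambda>t. real (Suc n) * (Bernstein n k t * g t - Bernstein n (Suc k) t * g t)
      + Bernstein (Suc n) (Suc k) t * g' t)"
    by (auto simp: algebra_simps)
  finally have I: "integral {0..1} (\<lambda>t. real (Suc n) * (Bernstein n k t * g t - Bernstein n (Suc k) t * g t)
      + Bernstein (Suc n) (Suc k) t * g' t) = 0"
    by (rule integral_unique)
  have "(\<lambda>t. real (Suc n) * (Bernstein n k t * g t - Bernstein n (Suc k) t * g t)) integrable_on {0..1}"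
    by (intro integrable_continuous_interval continuous_intros cg)
  with I i have "real (Suc n) * (integral {0..1} (\<lambda>t. Bernstein n k t * g t)
      - integral {0..1} (\<lambda>t. Bernstein n (Suc k) t * g t))
      + integral {0..1} (\<lambda>t. Bernstein (Suc n) (Suc k) t * g' t) = 0"
    by (simp add: Henstock_Kurzweil_Integration.integral_diff
        Henstock_Kurzweil_Integration.integral_add del: of_nat_Suc)
  then show ?thesis
    by (simp add: algebra_simps)
qed

lemma has_real_derivative_bernstein_durrmeyer:
  assumes d: "\<And>x. x \<in> {0..1} \<Longrightarrow> (g has_real_derivative g' x) (at x within {0..1})"
    and cont: "continuous_on {0..1} g'"
  shows "(bernstein_durrmeyer (Suc N) g has_real_derivative durrmeyer_deriv N g' x) (at x within S)"
proof -
  define c where "c k = integral {0..1} (\<lambda>t. Bernstein (Suc N) k t * g t)" for k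
  have cg: "continuous_on {0..1} g"
    using d DERIV_continuous_on by blast
  have "(LINT t:{0..1}|lebesgue. Bernstein (Suc N) k t * g t) = c k" for k
    unfolding c_def
    by (intro set_lebesgue_integral_eq_integral absolutely_integrable_continuous_real
        continuous_intros cg)
  then have D: "bernstein_durrmeyer (Suc N) g =
      (\<lambda>x. (real (Suc N) + 1) * (\<Sum>k\<le>Suc N. Bernstein (Suc N) k x * c k))"
    by (auto simp: bernstein_durrmeyer_def atLeast0AtMost)
  have "(bernstein_durrmeyer (Suc N) g has_real_derivative (real (Suc N) + 1) *
      (real (Suc N) * (\<Sum>k\<le>N. Bernstein N k x * (c (Suc k) - c k)))) (at x within S)"
    unfolding D by (intro DERIV_cmult has_real_derivative_Bernstein_combination)
  also have "(real (Suc N) + 1) * (real (Suc N) * (\<Sum>k\<le>N. Bernstein N k x * (c (Suc k) - c k)))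
      = real (Suc N) * (\<Sum>k\<le>N. Bernstein N k x * ((real (Suc N) + 1) * (c (Suc k) - c k)))"
    by (simp only: sum_distrib_left mult.left_commute)
  also have "\<dots> = durrmeyer_deriv N g' x"
    unfolding durrmeyer_deriv_def
    using integral_Bernstein_by_parts[OF d cont, of _ "Suc N"]
    by (intro arg_cong2[where f = "(*)"] sum.cong refl) (auto simp: c_def)
  finally show ?thesis .
qed

lemma durrmeyer_deriv_const: "durrmeyer_deriv N (\<lambda>t. c) x = c * (real N + 1) / (real N + 3)"
proof -
  have "durrmeyer_deriv N (\<lambda>t. c) x =
      real (Suc N) * (\<Sum>k\<le>N. Bernstein N k x * (c / (real N + 3)))"
    unfolding durrmeyer_deriv_def
    by (intro arg_cong2[where f = "(*)"] sum.cong refl) (auto simp: integral_Bernstein add.commute)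
  also have "\<dots> = real (Suc N) * (c / (real N + 3))"
    unfolding sum_distrib_right[symmetric] sum_Bernstein by simp
  finally show ?thesis
    by (simp add: mult.commute add.commute)
qed

text \<open>
  Over the common denominator the terms quadratic in \<open>r = N\<close> cancel in the sum over \<open>k\<close>. With the
  factor in front of that sum this leaves
  \<open>(r + 1) ((2 r - 20) x (1 - x) + 6) / ((r + 3) (r + 4) (r + 5))\<close>, a quantity of
  order \<open>1 / r\<close>.
\<close>

lemma durrmeyer_deriv_square_dist:
  assumes "x \<in> {0..1}"
  shows "durrmeyer_deriv N (\<lambda>t. (t - x)\<^sup>2) x \<le> 2 / real (Suc N)"
proof -
  define r where "r = real N"
  have r: "0 \<le> r" by (simp add: r_def)
  define A where "A = (r + 3) * (r + 4) * (r + 5)"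
  have A: "A > 0" using r by (simp add: A_def)
  \<comment> \<open>Written in the basis \<open>k (k - 1)\<close>, \<open>k\<close>, \<open>1\<close>, in which the sums against the Bernstein
    polynomials are known.\<close>
  have "Bernstein N k x * integral {0..1} (\<lambda>t. Bernstein (N + 2) (Suc k) t * (t - x)\<^sup>2) =
      (1 / A) * (real k * (real k - 1) * Bernstein N k x)
      + ((6 - 2 * x * (r + 5)) / A) * (real k * Bernstein N k x)
      + ((6 - 4 * x * (r + 5) + x\<^sup>2 * (r + 4) * (r + 5)) / A) * Bernstein N k x"
    if "k \<le> N" for k
  proof -
    have "integral {0..1} (\<lambda>t. Bernstein (N + 2) (Suc k) t * (t - x)\<^sup>2) =
      (real k + 2) * (real k + 3) / ((r + 3) * (r + 4) * (r + 5))
      - 2 * x * ((real k + 2) / ((r + 3) * (r + 4))) + x\<^sup>2 * (1 / (r + 3))"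
      using integral_square_dist_Bernstein[of "Suc k" "N + 2" x] that
      by (simp add: r_def algebra_simps)
    also have "\<dots> = ((real k + 2) * (real k + 3) - 2 * x * (real k + 2) * (r + 5)
        + x\<^sup>2 * (r + 4) * (r + 5)) / A"
      using r unfolding A_def by (simp add: divide_simps)
    finally have eq: "integral {0..1} (\<lambda>t. Bernstein (N + 2) (Suc k) t * (t - x)\<^sup>2) =
      ((real k + 2) * (real k + 3) - 2 * x * (real k + 2) * (r + 5)
        + x\<^sup>2 * (r + 4) * (r + 5)) / A" .
    show ?thesis
      unfolding eq using A by (simp add: field_simps)
  qed
  moreover have combination: "(\<Sum>k\<le>N. \<alpha> * (real k * (real k - 1) * Bernstein N k x)
      + \<beta> * (real k * Bernstein N k x) + \<gamma> * Bernstein N k x) =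
      \<alpha> * (r * (r - 1) * x\<^sup>2) + \<beta> * (r * x) + \<gamma>" for \<alpha> \<beta> \<gamma> :: real
    by (simp add: sum.distrib r_def flip: sum_distrib_left)
  ultimately have "durrmeyer_deriv N (\<lambda>t. (t - x)\<^sup>2) x = (r + 1) *
     ((1 / A) * (r * (r - 1) * x\<^sup>2) + ((6 - 2 * x * (r + 5)) / A) * (r * x)
      + (6 - 4 * x * (r + 5) + x\<^sup>2 * (r + 4) * (r + 5)) / A)"
    using combination by (simp add: durrmeyer_deriv_def r_def add.commute[of 1]
        del: times_divide_eq_left times_divide_eq_right)
  also have "\<dots> = (r + 1) * ((2 * r - 20) * (x * (1 - x)) + 6) / A"
    using A by (simp add: field_simps power2_eq_square)
  also have "\<dots> \<le> (r + 1) * (2 * r + 6) / A"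
  proof -
    have xx: "0 \<le> x * (1 - x)" "x * (1 - x) \<le> 1"
      using assms mult_mono[of x 1 "1 - x" 1] by auto
    have "r * (x * (1 - x)) \<le> r * 1"
      using xx r by (intro mult_left_mono) auto
    then have "(2 * r - 20) * (x * (1 - x)) + 6 \<le> 2 * r + 6"
      using xx by (simp add: left_diff_distrib)
    then show ?thesis
      using r A by (intro divide_right_mono mult_left_mono) auto
  qed
  also have "\<dots> \<le> 2 / (r + 1)"
  proof -
    have "(r + 1) * (2 * r + 6) / A = 2 * (r + 1) / ((r + 4) * (r + 5))"
      using r unfolding A_def by (simp add: divide_simps) (simp add: algebra_simps)
    also have "\<dots> \<le> 2 / (r + 1)"
      using r by (simp add: divide_simps) (simp add: algebra_simps)
    finally show ?thesis .
  qed
  finally show ?thesis by (simp add: r_def add.commute)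
qed

lemma durrmeyer_deriv_add:
  assumes "continuous_on {0..1} \<phi>" "continuous_on {0..1} \<psi>"
  shows "durrmeyer_deriv N (\<lambda>t. \<phi> t + \<psi> t) x = durrmeyer_deriv N \<phi> x + durrmeyer_deriv N \<psi> x"
proof -
  have "integral {0..1} (\<lambda>t. Bernstein n k t * (\<phi> t + \<psi> t)) =
      integral {0..1} (\<lambda>t. Bernstein n k t * \<phi> t) + integral {0..1} (\<lambda>t. Bernstein n k t * \<psi> t)"
    for n k
    unfolding distrib_left
    by (intro Henstock_Kurzweil_Integration.integral_add integrable_continuous_interval
        continuous_intros assms)
  then show ?thesis
    by (simp add: durrmeyer_deriv_def distrib_left sum.distrib)
qed

lemma durrmeyer_deriv_cmult: "durrmeyer_deriv N (\<lambda>t. c * \<phi> t) x = c * durrmeyer_deriv N \<phi> x"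
  by (simp add: durrmeyer_deriv_def mult.left_commute[of _ c] flip: sum_distrib_left)

lemma abs_durrmeyer_deriv_le:
  assumes "continuous_on {0..1} \<phi>" "continuous_on {0..1} \<psi>"
    and "\<And>t. t \<in> {0..1} \<Longrightarrow> \<bar>\<phi> t\<bar> \<le> \<psi> t" and x: "x \<in> {0..1}"
  shows "\<bar>durrmeyer_deriv N \<phi> x\<bar> \<le> durrmeyer_deriv N \<psi> x"
proof -
  have I: "\<bar>integral {0..1} (\<lambda>t. Bernstein n k t * \<phi> t)\<bar> \<le> integral {0..1} (\<lambda>t. Bernstein n k t * \<psi> t)"
    for n k
    using integral_norm_bound_integral[of "\<lambda>t. Bernstein n k t * \<phi> t" "{0..1}"
        "\<lambda>t. Bernstein n k t * \<psi> t"] assms(3) Bernstein_nonneg[of _ n k]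
    by (simp add: abs_mult mult_left_mono integrable_continuous_interval continuous_on_mult
        continuous_on_Bernstein assms(1,2))
  have "\<bar>\<Sum>k\<le>N. Bernstein N k x * integral {0..1} (\<lambda>t. Bernstein (N + 2) (Suc k) t * \<phi> t)\<bar> \<le>
      (\<Sum>k\<le>N. Bernstein N k x * integral {0..1} (\<lambda>t. Bernstein (N + 2) (Suc k) t * \<psi> t))"
    using x Bernstein_nonneg[of x N] I
    by (intro order_trans[OF sum_abs] sum_mono) (auto simp: abs_mult intro!: mult_left_mono)
  then show ?thesis
    by (simp add: durrmeyer_deriv_def abs_mult mult_left_mono)
qed

text \<open>
  The operator is applied to \<open>\<bar>\<phi> t - \<phi> x\<bar> \<le> M2 \<bar>t - x\<bar>\<close>. In place of the Cauchy-Schwarz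
  inequality for the first absolute moment, \<open>\<bar>t - x\<bar>\<close> is dominated pointwise by
  \<open>(s (t - x)\<^sup>2 + 1 / s) / 2\<close>; the choice \<open>s = \<surd>n\<close> balances the two terms. The summand with
  \<open>M1\<close> comes from the defect \<open>2 / (n + 2)\<close> of the mass of the operator.
\<close>

lemma durrmeyer_deriv_approximation:
  assumes d: "\<And>x. x \<in> {0..1} \<Longrightarrow> (\<phi> has_real_derivative \<phi>' x) (at x within {0..1})"
    and M1: "\<bar>\<phi> x\<bar> \<le> M1" and M2: "\<And>t. t \<in> {0..1} \<Longrightarrow> \<bar>\<phi>' t\<bar> \<le> M2"
    and x: "x \<in> {0..1}" and n: "n = Suc N"
  shows "\<bar>durrmeyer_deriv N \<phi> x - \<phi> x\<bar> \<le> (2 * M1 + 3 / 2 * M2) / sqrt (real n)"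
proof -
  define s where "s = sqrt (real n)"
  have s: "s \<ge> 1" "s\<^sup>2 = real n" by (auto simp: s_def n)
  have M2_0: "0 \<le> M2" using M2[OF x] by linarith
  have c: "continuous_on {0..1} \<phi>"
    using d DERIV_continuous_on by blast
  have dist: "\<bar>\<phi> t - \<phi> x\<bar> \<le> M2 * s / 2 * (t - x)\<^sup>2 + M2 / (2 * s)" if "t \<in> {0..1}" for t
  proof -
    have "\<bar>\<phi> t - \<phi> x\<bar> \<le> M2 * \<bar>t - x\<bar>"
      using field_differentiable_bound[of "{0..1}" \<phi> \<phi>' M2 t x] d M2 x that by auto
    also have "\<dots> \<le> M2 * ((s * (t - x)\<^sup>2 + 1 / s) / 2)"
    proof (intro mult_left_mono M2_0)
      have "0 \<le> (s * \<bar>t - x\<bar> - 1)\<^sup>2" by simp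
      then show "\<bar>t - x\<bar> \<le> (s * (t - x)\<^sup>2 + 1 / s) / 2"
        using s(1) by (simp add: field_simps power2_eq_square)
    qed
    finally show ?thesis using s(1) by (simp add: field_simps)
  qed
  have "\<bar>durrmeyer_deriv N (\<lambda>t. \<phi> t - \<phi> x) x\<bar> \<le>
      durrmeyer_deriv N (\<lambda>t. M2 * s / 2 * (t - x)\<^sup>2 + M2 / (2 * s)) x"
    by (intro abs_durrmeyer_deriv_le continuous_intros c dist x)
  also have "\<dots> = M2 * s / 2 * durrmeyer_deriv N (\<lambda>t. (t - x)\<^sup>2) x
      + M2 / (2 * s) * (real N + 1) / (real N + 3)"
    by (subst durrmeyer_deriv_add)
      (auto intro!: continuous_intros
        simp: durrmeyer_deriv_cmult durrmeyer_deriv_const simp del: times_divide_eq_left)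
  also have "\<dots> \<le> M2 * s / 2 * (2 / s\<^sup>2) + M2 / (2 * s)"
  proof (rule add_mono)
    show "M2 * s / 2 * durrmeyer_deriv N (\<lambda>t. (t - x)\<^sup>2) x \<le> M2 * s / 2 * (2 / s\<^sup>2)"
      using durrmeyer_deriv_square_dist[OF x, of N] s M2_0 by (intro mult_left_mono) (auto simp: n)
    have "M2 / (2 * s) * ((real N + 1) / (real N + 3)) \<le> M2 / (2 * s) * 1"
      using s(1) M2_0 by (intro mult_left_mono) auto
    then show "M2 / (2 * s) * (real N + 1) / (real N + 3) \<le> M2 / (2 * s)" by simp
  qed
  also have "\<dots> = 3 / 2 * M2 / s"
    using s(1) by (simp add: field_simps power2_eq_square)
  finally have main: "\<bar>durrmeyer_deriv N (\<lambda>t. \<phi> t - \<phi> x) x\<bar> \<le> 3 / 2 * M2 / s" .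
  have "durrmeyer_deriv N \<phi> x = durrmeyer_deriv N (\<lambda>t. (\<phi> t - \<phi> x) + \<phi> x) x"
    by simp
  also have "\<dots> = durrmeyer_deriv N (\<lambda>t. \<phi> t - \<phi> x) x + \<phi> x * (real N + 1) / (real N + 3)"
    by (subst durrmeyer_deriv_add) (auto intro!: continuous_intros c simp: durrmeyer_deriv_const)
  finally have split: "durrmeyer_deriv N \<phi> x - \<phi> x =
      durrmeyer_deriv N (\<lambda>t. \<phi> t - \<phi> x) x - \<phi> x * (2 / (real N + 3))"
    by (simp add: field_simps)
  have "\<bar>\<phi> x * (2 / (real N + 3))\<bar> \<le> M1 * (2 / s)"
  proof -
    have "s * 1 \<le> s * s" using s(1) by (intro mult_left_mono) auto
    then have "s \<le> real N + 3" using s(2) by (simp add: n power2_eq_square)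
    then have "2 / (real N + 3) \<le> 2 / s" using s(1) by (intro divide_left_mono) auto
    then show ?thesis
      using M1 s(1) unfolding abs_mult by (intro mult_mono) auto
  qed
  then have "\<bar>durrmeyer_deriv N \<phi> x - \<phi> x\<bar> \<le> 3 / 2 * M2 / s + M1 * (2 / s)"
    unfolding split using main by linarith
  also have "\<dots> = (2 * M1 + 3 / 2 * M2) / s"
    by (simp add: add_divide_distrib)
  finally show ?thesis by (simp add: s_def)
qed

section \<open>The estimate for the variation\<close>

theorem theorem4p1:
  shows "\<exists>C::real. C > 1 \<and>
    (\<forall>(g::real \<Rightarrow> real) (g'::real \<Rightarrow> real) (g''::real \<Rightarrow> real) (n::nat).
       (\<forall>x\<in>{0..1}. (g has_real_derivative g' x) (at x within {0..1})) \<longrightarrow>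
       (\<forall>x\<in>{0..1}. (g' has_real_derivative g'' x) (at x within {0..1})) \<longrightarrow>
       abs_continuous_on_interval 0 1 g'' \<longrightarrow>
       n \<ge> 1 \<longrightarrow>
       total_variation 0 1 (\<lambda>x. bernstein_durrmeyer n g x - g x)
         \<le> ennreal (2 * (C + 1) / sqrt (real n)) *
             (total_variation 0 1 g + total_variation 0 1 g''))"
  \<comment> \<open>With \<open>M1 = 21 V + W\<close> and \<open>M2 = 18 V + W\<close> the factor \<open>2 M1 + 3/2 M2\<close> equals
    \<open>69 V + 7/2 W\<close>, which is at most \<open>2 (34 + 1) (V + W)\<close>.\<close>
proof (intro exI[of _ 34] conjI allI impI)
  fix g g' g'' :: "real \<Rightarrow> real" and n :: nat
  assume "\<forall>x\<in>{0..1}. (g has_real_derivative g' x) (at x within {0..1})"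
    and "\<forall>x\<in>{0..1}. (g' has_real_derivative g'' x) (at x within {0..1})"
    and n: "n \<ge> 1"
  then have d1: "\<And>x. x \<in> {0..1} \<Longrightarrow> (g has_real_derivative g' x) (at x within {0..1})"
    and d2: "\<And>x. x \<in> {0..1} \<Longrightarrow> (g' has_real_derivative g'' x) (at x within {0..1})" by auto
  obtain N where N: "n = Suc N" using n by (cases n) auto
  have coeff: "ennreal (2 * (34 + 1) / sqrt (real n)) \<noteq> 0"
    using n by (simp add: ennreal_eq_0_iff)
  show "total_variation 0 1 (\<lambda>x. bernstein_durrmeyer n g x - g x)
      \<le> ennreal (2 * (34 + 1) / sqrt (real n)) * (total_variation 0 1 g + total_variation 0 1 g'')"
  \<comment> \<open>If the sum of the variations is infinite, then so is the right-hand side.\<close>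
  proof (cases "total_variation 0 1 g + total_variation 0 1 g'' = top")
    case True
    then show ?thesis unfolding True using coeff by (simp add: ennreal_mult_top del: ennreal_eq_0_iff)
  next
    case False
    then obtain V W where V: "total_variation 0 1 g = ennreal V" "0 \<le> V"
      and W: "total_variation 0 1 g'' = ennreal W" "0 \<le> W"
      by (cases "total_variation 0 1 g"; cases "total_variation 0 1 g''") auto
    note bounds = derivative_bounds_by_variations[OF d1 d2 V W]
    have cont: "continuous_on {0..1} g'"
      using d2 DERIV_continuous_on by blast
    have "total_variation 0 1 (\<lambda>x. bernstein_durrmeyer n g x - g x) \<le>
        ennreal ((2 * (21 * V + W) + 3 / 2 * (18 * V + W)) / sqrt (real n) * (1 - 0))"
    proof (rule total_variation_le_derivative_bound)
      fix x :: real assume x: "x \<in> {0..1}"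
      show "((\<lambda>x. bernstein_durrmeyer n g x - g x) has_real_derivative durrmeyer_deriv N g' x - g' x)
          (at x within {0..1})"
        unfolding N by (intro DERIV_diff has_real_derivative_bernstein_durrmeyer d1 cont x)
      show "\<bar>durrmeyer_deriv N g' x - g' x\<bar> \<le>
          (2 * (21 * V + W) + 3 / 2 * (18 * V + W)) / sqrt (real n)"
        by (intro durrmeyer_deriv_approximation[OF d2] bounds x N)
    qed simp
    also have "\<dots> \<le> ennreal (2 * (34 + 1) / sqrt (real n) * (V + W))"
      using V W by (intro ennreal_leI) (simp add: divide_right_mono)
    also have "\<dots> = ennreal (2 * (34 + 1) / sqrt (real n)) *
        (total_variation 0 1 g + total_variation 0 1 g'')"
      unfolding V(1) W(1) by (subst ennreal_mult) (use V(2) W(2) in \<open>simp_all add: ennreal_plus\<close>)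
    finally show ?thesis .
  qed
qed simp

end
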